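(* Let $Q=T[H_1,\dots,H_t]$ be a strong semicomplete composition with $T\notin\mathcal{T}_1$. Then every minimal separator $S$ of $Q$ induces in $\overline{U(Q)}$ a subgraph which consists of some connected components of $\overline{U(Q)}$ (that is, $S$ is a union of vertex sets of connected components of $\overline{U(Q)}$). Moreover, each vertex $s\in S$ is adjacent in $Q$ to every vertex of $Q-S$ (i.e., for every $x\in V(Q)\setminus S$ there is at least one arc between $s$ and $x$ in $Q$).
   Context: Digraphs are finite, without loops or parallel arcs (2-cycles are allowed). A digraph is semicomplete if there is at least one arc between every pair of distinct vertices. Let $T$ be a digraph with vertices $u_1,\dots,u_t$ ($t\ge 2$) and let $H_1,\dots,H_t$ be pairwise disjoint nonempty digraphs, where $H_i$ has $n_i$ vertices. The composition $Q=T[H_1,\dots,H_t]$ is the digraph with vertex set $\bigcup_i V(H_i)$ and arc set $\bigcup_{i=1}^t A(H_i)\cup\{xy : x\in V(H_i),\ y\in V(H_p),\ u_iu_p\in A(T)\}$. It is a semicomplete composition if $T$ is semicomplete. A digraph is strong if for every ordered pair of vertices $(x,y)$ there is a directed path from $x$ to $y$ (a one-vertex digraph is strong). $\mathcal{T}_1$ is the set of all semicomplete digraphs $T$ for which there exists a vertex $u$ such that $uv,vu\in A(T)$ for every $v\in V(T)\setminus\{u\}$. $U(D)$ denotes the underlying undirected graph of $D$, and $\overline{G}$ the complement of a graph $G$. A set $S\subseteq V(D)$ is a separator of $D$ if $D-S$ is not strong; a separator is minimal if no proper subset of it is a separator. *)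

theory Defs
  imports "Graph_Theory.Graph_Theory" "HOL-Library.Disjoint_Sets"
begin

definition semicomplete :: "'a pair_pre_digraph \<Rightarrow> bool" where
  "semicomplete D \<longleftrightarrow>
     (\<forall>x\<in>pverts D. \<forall>y\<in>pverts D. x \<noteq> y \<longrightarrow> (x, y) \<in> parcs D \<or> (y, x) \<in> parcs D)"

text \<open>The factors are indexed by the vertices of \<open>T\<close> themselves: \<open>H u\<close> is the digraph
  substituted for the vertex \<open>u\<close>.\<close>

definition composition ::
  "'i pair_pre_digraph \<Rightarrow> ('i \<Rightarrow> 'a pair_pre_digraph) \<Rightarrow> 'a pair_pre_digraph" where
  "composition T H =
     \<lparr> pverts = (\<Union>u\<in>pverts T. pverts (H u)),
       parcs = (\<Union>u\<in>pverts T. parcs (H u)) \<union>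
               {(x, y). \<exists>u v. (u, v) \<in> parcs T \<and> x \<in> pverts (H u) \<and> y \<in> pverts (H v)} \<rparr>"

text \<open>Unlike \<^const>\<open>strongly_connected\<close>, this holds for the null digraph, so the full vertex
  set of a digraph is never a separator.\<close>

definition strong :: "('a, 'b) pre_digraph \<Rightarrow> bool" where
  "strong D \<longleftrightarrow> (\<forall>x\<in>verts D. \<forall>y\<in>verts D. x \<rightarrow>\<^sup>*\<^bsub>D\<^esub> y)"

definition class_T1 :: "'a pair_pre_digraph set" where
  "class_T1 = {T. pair_digraph T \<and> semicomplete T \<and>
     (\<exists>u\<in>pverts T. \<forall>v\<in>pverts T - {u}. (u, v) \<in> parcs T \<and> (v, u) \<in> parcs T)}"

definition separator :: "('a, 'b) pre_digraph \<Rightarrow> 'a set \<Rightarrow> bool" where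
  "separator D S \<longleftrightarrow> S \<subseteq> verts D \<and> \<not> strong (D \<restriction> (verts D - S))"

definition minimal_separator :: "('a, 'b) pre_digraph \<Rightarrow> 'a set \<Rightarrow> bool" where
  "minimal_separator D S \<longleftrightarrow> separator D S \<and> (\<forall>S'. S' \<subset> S \<longrightarrow> \<not> separator D S')"

text \<open>Undirected graphs are symmetric digraphs. The underlying graph of a digraph is
  \<^const>\<open>mk_symmetric\<close>, and the connected components of a symmetric digraph are its
  strongly connected components \<^const>\<open>pre_digraph.sccs\<close>.\<close>

definition graph_complement :: "'a pair_pre_digraph \<Rightarrow> 'a pair_pre_digraph" where
  "graph_complement G =
     \<lparr> pverts = pverts G,
       parcs = {(x, y). x \<in> pverts G \<and> y \<in> pverts G \<and> x \<noteq> y \<and> (x, y) \<notin> parcs G} \<rparr>"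

lemma strong_conv_strongly_connected:
  "strong D \<longleftrightarrow> verts D = {} \<or> strongly_connected D"
  by (auto simp: strong_def strongly_connected_def)

lemma pair_digraph_composition:
  assumes T: "pair_digraph T"
    and H: "\<And>u. u \<in> pverts T \<Longrightarrow> pair_digraph (H u)"
    and disj: "disjoint_family_on (\<lambda>u. pverts (H u)) (pverts T)"
  shows "pair_digraph (composition T H)"
proof -
  interpret T: pair_digraph T by (rule T)
  have wf: "x \<in> pverts (H u)" "y \<in> pverts (H u)" "x \<noteq> y"
    if "u \<in> pverts T" "(x, y) \<in> parcs (H u)" for u x y
  proof -
    interpret pair_digraph "H u" by (rule H[OF that(1)])
    show "x \<in> pverts (H u)" "y \<in> pverts (H u)" "x \<noteq> y"
      using that(2) in_arcsD1 in_arcsD2 no_loops' by auto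
  qed
  let ?Q = "composition T H"
  have fin: "finite (pverts ?Q)"
    using T.pair_finite_verts H
    by (auto simp: composition_def pair_digraph_def pair_fin_digraph_def pair_fin_digraph_axioms_def)
  have arcs: "x \<in> pverts ?Q \<and> y \<in> pverts ?Q \<and> x \<noteq> y" if xy: "(x, y) \<in> parcs ?Q" for x y
  proof -
    consider u where "u \<in> pverts T" "(x, y) \<in> parcs (H u)"
      | u v where "(u, v) \<in> parcs T" "x \<in> pverts (H u)" "y \<in> pverts (H v)"
      using xy by (auto simp: composition_def)
    then show ?thesis
    proof cases
      case 1
      then show ?thesis using wf[OF 1] by (auto simp: composition_def)
    next
      case 2
      then have "u \<in> pverts T" "v \<in> pverts T" "u \<noteq> v"
        using T.in_arcsD1 T.in_arcsD2 T.no_loops' by auto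
      then show ?thesis using 2 disj by (auto simp: composition_def disjoint_family_on_def)
    qed
  qed
  then have "parcs ?Q \<subseteq> pverts ?Q \<times> pverts ?Q" by auto
  then have "finite (parcs ?Q)" using fin by (meson finite_SigmaI finite_subset)
  then show ?thesis using fin arcs by unfold_locales (auto simp: prod_eq_iff)
qed

lemma pair_graph_graph_complement_mk_symmetric:
  assumes "pair_digraph D"
  shows "pair_graph (graph_complement (mk_symmetric D))"
proof -
  interpret pair_digraph D by (rule assms)
  have "finite {(x, y). x \<in> pverts D \<and> y \<in> pverts D \<and> x \<noteq> y \<and> (x, y) \<notin> parcs (mk_symmetric D)}"
    by (rule finite_subset[of _ "pverts D \<times> pverts D"]) (auto simp: pair_finite_verts)
  then show ?thesis
    using pair_finite_verts
    by unfold_locales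
      (auto simp: graph_complement_def symmetric_def sym_def parcs_mk_symmetric)
qed

end

theory Submission
  imports Defs
begin

text \<open>The factors of \<open>Q\<close> are modules: a vertex outside \<open>H u\<close> does not distinguish two vertices of
  \<open>H u\<close>. If \<open>S\<close> is a minimal separator and \<open>(A, B)\<close> a partition of its complement without arcs
  from \<open>B\<close> to \<open>A\<close>, then no such pair covers a larger set, and so every vertex of \<open>S\<close> has an
  in-neighbour in \<open>B\<close> and an out-neighbour in \<open>A\<close>. Suppose that a module \<open>M\<close> contains \<open>s \<in> S\<close> and
  \<open>x \<notin> S\<close>. As \<open>x\<close> has the same neighbours outside \<open>M\<close> as \<open>s\<close>, one of these neighbours of \<open>s\<close> lies
  in \<open>M\<close>, so \<open>M\<close> meets both \<open>A\<close> and \<open>B\<close>. Either side could then absorb \<open>M\<close> if \<open>M\<close> did not contain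
  the other side, hence \<open>A \<union> B \<subseteq> M\<close>. A factor \<open>H u\<close> cannot be such a module when \<open>T \<notin> \<T>\<^sub>1\<close>: some
  \<open>w\<close> does not form a 2-cycle with \<open>u\<close>, and \<open>H u\<close> and \<open>H w\<close> are then the sides of a larger pair.
  Hence \<open>S\<close> is a union of factors, and vertices of different factors are adjacent.\<close>

section \<open>Directed cuts and minimal separators\<close>

definition dicut :: "('a, 'b) pre_digraph \<Rightarrow> 'a set \<Rightarrow> 'a set \<Rightarrow> bool" where
  "dicut G A B \<longleftrightarrow> A \<noteq> {} \<and> B \<noteq> {} \<and> A \<inter> B = {} \<and> A \<union> B \<subseteq> verts G \<and>
     (\<forall>a\<in>A. \<forall>b\<in>B. \<not> b \<rightarrow>\<^bsub>G\<^esub> a)"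

lemma (in wf_digraph) reachable_in_closed_set:
  assumes "u \<rightarrow>\<^sup>* v" and "u \<in> S" and "\<And>x y. x \<in> S \<Longrightarrow> x \<rightarrow> y \<Longrightarrow> y \<in> S"
  shows "v \<in> S"
  using assms by (induction rule: reachable_induct) auto

lemma (in wf_digraph) strong_iff_no_spanning_dicut:
  "strong G \<longleftrightarrow> (\<nexists>A B. dicut G A B \<and> A \<union> B = verts G)"
proof
  assume strong: "strong G"
  show "\<nexists>A B. dicut G A B \<and> A \<union> B = verts G"
  proof
    assume "\<exists>A B. dicut G A B \<and> A \<union> B = verts G"
    then obtain A B a b where cut: "dicut G A B" "A \<union> B = verts G" and ab: "a \<in> A" "b \<in> B"
      unfolding dicut_def by blast
    have "b \<rightarrow>\<^sup>* a"
      using strong cut(2) ab by (auto simp: strong_def)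
    moreover have "y \<in> B" if "x \<in> B" "x \<rightarrow> y" for x y
      using cut that adj_in_verts(2)[OF that(2)] by (auto simp: dicut_def)
    ultimately have "a \<in> B"
      using ab(2) by (blast intro: reachable_in_closed_set)
    then show False
      using cut(1) ab(1) by (auto simp: dicut_def)
  qed
next
  assume no_cut: "\<nexists>A B. dicut G A B \<and> A \<union> B = verts G"
  have "p \<rightarrow>\<^sup>* q" if pq: "p \<in> verts G" "q \<in> verts G" for p q
  proof (rule ccontr)
    assume unreachable: "\<not> p \<rightarrow>\<^sup>* q"
    define B where "B = {z. p \<rightarrow>\<^sup>* z}"
    have "B \<subseteq> verts G" "p \<in> B" "q \<in> verts G - B"
      using pq unreachable by (auto simp: B_def dest: reachable_in_verts)
    moreover have "\<not> b \<rightarrow> a" if "b \<in> B" "a \<in> verts G - B" for a b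
      using that reachable_adj_trans by (auto simp: B_def)
    ultimately have "dicut G (verts G - B) B \<and> (verts G - B) \<union> B = verts G"
      unfolding dicut_def by blast
    then show False
      using no_cut by blast
  qed
  then show "strong G"
    by (simp add: strong_def)
qed

lemma (in wf_digraph) dicut_induce_subgraph_iff:
  assumes "X \<subseteq> verts G" and "A \<union> B \<subseteq> X"
  shows "dicut (G \<restriction> X) A B \<longleftrightarrow> dicut G A B"
proof -
  have "b \<rightarrow>\<^bsub>G \<restriction> X\<^esub> a \<longleftrightarrow> b \<rightarrow> a" if "a \<in> A" "b \<in> B" for a b
    using that assms(2) by (auto simp: arcs_ends_conv)
  then show ?thesis
    using assms by (auto simp: dicut_def)
qed

lemma (in wf_digraph) separator_iff_dicut:
  "separator G S \<longleftrightarrow> S \<subseteq> verts G \<and> (\<exists>A B. dicut G A B \<and> A \<union> B = verts G - S)"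
proof -
  interpret R: wf_digraph "G \<restriction> (verts G - S)"
    by (rule wellformed_induce_subgraph)
  have "dicut (G \<restriction> (verts G - S)) A B \<and> A \<union> B = verts G - S \<longleftrightarrow>
      dicut G A B \<and> A \<union> B = verts G - S" for A B
    using dicut_induce_subgraph_iff[of "verts G - S" A B] by blast
  then show ?thesis
    by (simp add: separator_def R.strong_iff_no_spanning_dicut)
qed

lemma (in wf_digraph) minimal_separatorE:
  assumes "minimal_separator G S"
  obtains A B where "dicut G A B" "A \<union> B = verts G - S"
  using assms unfolding minimal_separator_def separator_iff_dicut by blast

lemma (in wf_digraph) minimal_separator_dicut_maximal:
  assumes min: "minimal_separator G S"
    and cut: "dicut G A B" and cover: "verts G - S \<subseteq> A \<union> B"
  shows "A \<union> B = verts G - S"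
proof -
  have sub: "A \<union> B \<subseteq> verts G"
    using cut by (simp add: dicut_def)
  then have "A \<union> B = verts G - (verts G - (A \<union> B))"
    by blast
  with cut have "separator G (verts G - (A \<union> B))"
    unfolding separator_iff_dicut by blast
  then have "\<not> verts G - (A \<union> B) \<subset> S"
    using min by (auto simp: minimal_separator_def)
  then show ?thesis
    using sub cover by blast
qed

lemma (in wf_digraph) minimal_separator_neighbours:
  assumes min: "minimal_separator G S" and s: "s \<in> S"
    and cut: "dicut G A B" and cover: "A \<union> B = verts G - S"
  shows "\<exists>b\<in>B. b \<rightarrow> s" and "\<exists>a\<in>A. s \<rightarrow> a"
proof -
  have s_verts: "s \<in> verts G"
    using min s by (auto simp: minimal_separator_def separator_def)
  have "\<not> dicut G (insert s A) B"
    using minimal_separator_dicut_maximal[OF min, of "insert s A" B] cover s by blast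
  then show "\<exists>b\<in>B. b \<rightarrow> s"
    using cut cover s s_verts by (auto simp: dicut_def)
  have "\<not> dicut G A (insert s B)"
    using minimal_separator_dicut_maximal[OF min, of A "insert s B"] cover s by blast
  then show "\<exists>a\<in>A. s \<rightarrow> a"
    using cut cover s s_verts by (auto simp: dicut_def)
qed

section \<open>Modules\<close>

definition digraph_module :: "('a, 'b) pre_digraph \<Rightarrow> 'a set \<Rightarrow> bool" where
  "digraph_module G M \<longleftrightarrow> M \<subseteq> verts G \<and>
     (\<forall>y\<in>verts G - M. \<forall>z\<in>M. \<forall>z'\<in>M. (y \<rightarrow>\<^bsub>G\<^esub> z \<longleftrightarrow> y \<rightarrow>\<^bsub>G\<^esub> z') \<and> (z \<rightarrow>\<^bsub>G\<^esub> y \<longleftrightarrow> z' \<rightarrow>\<^bsub>G\<^esub> y))"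

lemma digraph_moduleD:
  assumes "digraph_module G M" and "y \<in> verts G - M" and "z \<in> M" and "z' \<in> M"
  shows "y \<rightarrow>\<^bsub>G\<^esub> z \<Longrightarrow> y \<rightarrow>\<^bsub>G\<^esub> z'" and "z \<rightarrow>\<^bsub>G\<^esub> y \<Longrightarrow> z' \<rightarrow>\<^bsub>G\<^esub> y"
  using assms unfolding digraph_module_def by blast+

lemma dicut_absorb_module:
  assumes cut: "dicut G A B" and M: "digraph_module G M"
  shows "A - M \<noteq> {} \<Longrightarrow> B \<inter> M \<noteq> {} \<Longrightarrow> dicut G (A - M) (B \<union> M)"
    and "B - M \<noteq> {} \<Longrightarrow> A \<inter> M \<noteq> {} \<Longrightarrow> dicut G (A \<union> M) (B - M)"
proof -
  have sub: "A \<union> B \<union> M \<subseteq> verts G"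
    using cut M by (auto simp: dicut_def digraph_module_def)
  have no_arc: "\<not> b \<rightarrow>\<^bsub>G\<^esub> a" if "a \<in> A" "b \<in> B" for a b
    using cut that by (simp add: dicut_def)
  show "dicut G (A - M) (B \<union> M)" if ne: "A - M \<noteq> {}" and meet: "B \<inter> M \<noteq> {}"
  proof -
    obtain q where q: "q \<in> B" "q \<in> M"
      using meet by blast
    have "\<not> z \<rightarrow>\<^bsub>G\<^esub> a" if "a \<in> A - M" "z \<in> M" for a z
      using digraph_moduleD(2)[OF M _ that(2) q(2), of a] no_arc[OF _ q(1)] sub that(1) by blast
    then show ?thesis
      using cut ne sub no_arc unfolding dicut_def by blast
  qed
  show "dicut G (A \<union> M) (B - M)" if ne: "B - M \<noteq> {}" and meet: "A \<inter> M \<noteq> {}"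
  proof -
    obtain p where p: "p \<in> A" "p \<in> M"
      using meet by blast
    have "\<not> b \<rightarrow>\<^bsub>G\<^esub> z" if "b \<in> B - M" "z \<in> M" for b z
      using digraph_moduleD(1)[OF M _ that(2) p(2), of b] no_arc[OF p(1)] sub that(1) by blast
    then show ?thesis
      using cut ne sub no_arc unfolding dicut_def by blast
  qed
qed

lemma (in wf_digraph) minimal_separator_module_meets_dicut:
  assumes min: "minimal_separator G S" and M: "digraph_module G M"
    and s: "s \<in> M \<inter> S" and x: "x \<in> M - S"
    and cut: "dicut G A B" and cover: "A \<union> B = verts G - S"
  shows "A \<inter> M \<noteq> {}" and "B \<inter> M \<noteq> {}"
proof -
  obtain a b where b: "b \<in> B" "b \<rightarrow> s" and a: "a \<in> A" "s \<rightarrow> a"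
    using minimal_separator_neighbours[OF min _ cut cover] s by blast
  have no_arc: "\<not> b' \<rightarrow> a'" if "a' \<in> A" "b' \<in> B" for a' b'
    using cut that by (simp add: dicut_def)
  have "x \<in> A \<union> B"
    using M x cover by (auto simp: digraph_module_def)
  moreover have "b \<in> M" if "x \<in> A"
    using digraph_moduleD(1)[OF M, of b s x] no_arc[OF that b(1)] b s x adj_in_verts by blast
  moreover have "a \<in> M" if "x \<in> B"
    using digraph_moduleD(2)[OF M, of a s x] no_arc[OF a(1) that] a s x adj_in_verts by blast
  ultimately show "A \<inter> M \<noteq> {}" and "B \<inter> M \<noteq> {}"
    using a b x by blast+
qed

lemma (in wf_digraph) minimal_separator_module_cases:
  assumes min: "minimal_separator G S" and M: "digraph_module G M"
  obtains (disjoint) "M \<inter> S = {}" | (contained) "M \<subseteq> S" | (covering) "verts G - S \<subseteq> M"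
proof -
  have "verts G - S \<subseteq> M" if s: "s \<in> M \<inter> S" and x: "x \<in> M - S" for s x
  proof -
    obtain A B where cut: "dicut G A B" and cover: "A \<union> B = verts G - S"
      using min by (rule minimal_separatorE)
    note meets = minimal_separator_module_meets_dicut[OF min M s x cut cover]
    have "\<not> dicut G (A - M) (B \<union> M)" and "\<not> dicut G (A \<union> M) (B - M)"
      using minimal_separator_dicut_maximal[OF min, of "A - M" "B \<union> M"]
        minimal_separator_dicut_maximal[OF min, of "A \<union> M" "B - M"] cover s by blast+
    then have "A - M = {}" and "B - M = {}"
      using dicut_absorb_module[OF cut M] meets by blast+
    then show ?thesis
      using cover by blast
  qed
  then show thesis
    using that by blast
qed

section \<open>Compositions\<close>

locale digraph_composition = T: pair_digraph T
  for T :: "'i pair_pre_digraph" +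
  fixes H :: "'i \<Rightarrow> 'a pair_pre_digraph"
  assumes pair_digraph_factor: "u \<in> pverts T \<Longrightarrow> pair_digraph (H u)"
    and factor_nonempty: "u \<in> pverts T \<Longrightarrow> pverts (H u) \<noteq> {}"
    and disjoint_factors: "disjoint_family_on (\<lambda>u. pverts (H u)) (pverts T)"
begin

abbreviation Q :: "'a pair_pre_digraph" where
  "Q \<equiv> composition T H"

sublocale Q: pair_digraph Q
  using T.pair_digraph_axioms pair_digraph_factor disjoint_factors
  by (rule pair_digraph_composition)

lemma pverts_composition: "pverts Q = (\<Union>u\<in>pverts T. pverts (H u))"
  by (simp add: composition_def)

lemma factor_unique:
  assumes "u \<in> pverts T" "v \<in> pverts T" and "x \<in> pverts (H u)" "x \<in> pverts (H v)"
  shows "u = v"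
  using assms disjoint_factors by (auto simp: disjoint_family_on_def)

lemma arc_between_factors_iff:
  assumes uv: "u \<in> pverts T" "v \<in> pverts T" "u \<noteq> v"
    and xy: "x \<in> pverts (H u)" "y \<in> pverts (H v)"
  shows "(x, y) \<in> parcs Q \<longleftrightarrow> (u, v) \<in> parcs T"
proof -
  have "(x, y) \<notin> parcs (H i)" if i: "i \<in> pverts T" for i
  proof
    assume arc: "(x, y) \<in> parcs (H i)"
    interpret Hi: pair_digraph "H i"
      using i by (rule pair_digraph_factor)
    have "i = u" "i = v"
      using factor_unique[OF i] uv xy Hi.in_arcsD1[OF arc] Hi.in_arcsD2[OF arc] by blast+
    then show False
      using uv(3) by simp
  qed
  moreover have "i = u \<and> j = v"
    if "(i, j) \<in> parcs T" "x \<in> pverts (H i)" "y \<in> pverts (H j)" for i j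
    using that uv xy factor_unique T.in_arcsD1 T.in_arcsD2 by blast
  ultimately show ?thesis
    using xy by (auto simp: composition_def)
qed

lemma digraph_module_factor:
  assumes u: "u \<in> pverts T"
  shows "digraph_module (with_proj Q) (pverts (H u))"
proof -
  have "((y, z) \<in> parcs Q \<longleftrightarrow> (y, z') \<in> parcs Q) \<and> ((z, y) \<in> parcs Q \<longleftrightarrow> (z', y) \<in> parcs Q)"
    if y: "y \<in> pverts Q - pverts (H u)" and z: "z \<in> pverts (H u)" "z' \<in> pverts (H u)" for y z z'
  proof -
    obtain v where v: "v \<in> pverts T" "v \<noteq> u" "y \<in> pverts (H v)"
      using y by (auto simp: pverts_composition)
    then show ?thesis
      using arc_between_factors_iff u z by simp
  qed
  moreover have "pverts (H u) \<subseteq> pverts Q"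
    using u by (auto simp: pverts_composition)
  ultimately show ?thesis
    unfolding digraph_module_def with_proj_simps by blast
qed

lemma dicut_factors:
  assumes "u \<in> pverts T" "v \<in> pverts T" "u \<noteq> v" and "(v, u) \<notin> parcs T"
  shows "dicut (with_proj Q) (pverts (H u)) (pverts (H v))"
  using assms factor_nonempty factor_unique arc_between_factors_iff
  by (auto simp: dicut_def pverts_composition)

lemma minimal_separator_factor_cases:
  assumes semi: "semicomplete T" and not_T1: "T \<notin> class_T1"
    and min: "minimal_separator (with_proj Q) S" and u: "u \<in> pverts T"
  obtains (disjoint) "pverts (H u) \<inter> S = {}" | (contained) "pverts (H u) \<subseteq> S"
  using min digraph_module_factor[OF u]
proof (cases rule: Q.minimal_separator_module_cases)
  case covering
  obtain w where w: "w \<in> pverts T" "w \<noteq> u" "(u, w) \<notin> parcs T \<or> (w, u) \<notin> parcs T"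
    using not_T1 semi u T.pair_digraph_axioms unfolding class_T1_def by blast
  obtain A B where cut: "dicut (with_proj Q) A B" and AB: "A \<union> B = pverts (H u) \<union> pverts (H w)"
    using dicut_factors[OF u w(1)] dicut_factors[OF w(1) u] w(2,3) by blast
  have "A \<union> B = pverts Q - S"
    using Q.minimal_separator_dicut_maximal[OF min cut] covering AB by auto
  then show thesis
    using AB that(1) by blast
qed (use that in blast)+

lemma minimal_separator_adjacent:
  assumes semi: "semicomplete T" and not_T1: "T \<notin> class_T1"
    and min: "minimal_separator (with_proj Q) S" and s: "s \<in> S" and x: "x \<in> pverts Q - S"
  shows "(s, x) \<in> parcs Q \<or> (x, s) \<in> parcs Q"
proof -
  have "s \<in> pverts Q"
    using min s by (auto simp: minimal_separator_def separator_def)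
  then obtain u v where u: "u \<in> pverts T" "s \<in> pverts (H u)" and v: "v \<in> pverts T" "x \<in> pverts (H v)"
    using x by (auto simp: pverts_composition)
  have "u \<noteq> v"
    using minimal_separator_factor_cases[OF semi not_T1 min u(1)] u(2) v(2) s x by blast
  then show ?thesis
    using semi u v arc_between_factors_iff by (auto simp: semicomplete_def)
qed

end

section \<open>Unions of components\<close>

lemma (in sym_digraph) induce_closed_eq_Union_sccs:
  assumes S: "S \<subseteq> verts G"
    and closed: "\<And>u v. u \<in> S \<Longrightarrow> u \<rightarrow> v \<Longrightarrow> v \<in> S"
  shows "\<exists>\<C> \<subseteq> sccs. G \<restriction> S = Union \<C> \<and> S = (\<Union>C\<in>\<C>. verts C)"
proof -
  define component where "component u = G \<restriction> {v. u \<rightarrow>\<^sup>* v}" for u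
  have reach: "v \<in> S" if "u \<rightarrow>\<^sup>* v" "u \<in> S" for u v
    using that closed by (rule reachable_in_closed_set)
  have verts: "S = (\<Union>C\<in>component ` S. verts C)"
    using S reach by (auto simp: component_def)
  have "arcs (G \<restriction> S) = (\<Union>C\<in>component ` S. arcs C)"
  proof (intro equalityI subsetI)
    fix e assume "e \<in> arcs (G \<restriction> S)"
    then have e: "e \<in> arcs G" "tail G e \<in> S"
      by auto
    then have "e \<in> arcs (component (tail G e))"
      by (auto simp: component_def intro: in_arcs_imp_in_arcs_ends)
    with e(2) show "e \<in> (\<Union>C\<in>component ` S. arcs C)"
      by blast
  qed (use reach in \<open>auto simp: component_def\<close>)
  with verts have "G \<restriction> S = Union (component ` S)"
    by (simp add: Union_def induce_subgraph_def)
  moreover have "component ` S \<subseteq> sccs"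
    using S induce_reachable_is_in_sccs by (auto simp: component_def)
  ultimately show ?thesis
    using verts by blast
qed

lemma (in pair_digraph) induce_complement_eq_Union_sccs:
  fixes S :: "'a set"
  defines "K \<equiv> graph_complement (mk_symmetric (with_proj G))"
  assumes S: "S \<subseteq> pverts G"
    and adjacent: "\<And>s x. s \<in> S \<Longrightarrow> x \<in> pverts G - S \<Longrightarrow> (s, x) \<in> parcs G \<or> (x, s) \<in> parcs G"
  shows "\<exists>\<C> \<subseteq> pre_digraph.sccs (with_proj K).
    with_proj K \<restriction> S = pre_digraph.Union (with_proj K) \<C> \<and> S = (\<Union>C\<in>\<C>. verts C)"
proof -
  interpret K: pair_graph K
    unfolding K_def using pair_digraph_axioms by (rule pair_graph_graph_complement_mk_symmetric)
  have "S \<subseteq> pverts K"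
    using S by (simp add: K_def graph_complement_def)
  moreover have "v \<in> S" if "u \<in> S" "(u, v) \<in> parcs K" for u v
    using that adjacent[of u v] by (force simp: K_def graph_complement_def parcs_mk_symmetric)
  ultimately show ?thesis
    by (rule K.induce_closed_eq_Union_sccs)
qed

theorem theorem2p2:
  fixes T :: "'i pair_pre_digraph"
    and H :: "'i \<Rightarrow> 'a pair_pre_digraph"
    and Q :: "'a pair_pre_digraph"
    and S :: "'a set"
  assumes "pair_digraph T"
    and "card (pverts T) \<ge> 2"
    and "\<And>u. u \<in> pverts T \<Longrightarrow> pair_digraph (H u)"
    and "\<And>u. u \<in> pverts T \<Longrightarrow> pverts (H u) \<noteq> {}"
    and "disjoint_family_on (\<lambda>u. pverts (H u)) (pverts T)"
    and "Q = composition T H"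
    and "semicomplete T"
    and "strong (with_proj Q)"
    and "T \<notin> class_T1"
    and "minimal_separator (with_proj Q) S"
  shows "(\<exists>\<C> \<subseteq> pre_digraph.sccs (with_proj (graph_complement (mk_symmetric (with_proj Q)))).
            with_proj (graph_complement (mk_symmetric (with_proj Q))) \<restriction> S =
              pre_digraph.Union (with_proj (graph_complement (mk_symmetric (with_proj Q)))) \<C> \<and>
            S = (\<Union>C\<in>\<C>. verts C)) \<and>
         (\<forall>s\<in>S. \<forall>x\<in>pverts Q - S. (s, x) \<in> parcs Q \<or> (x, s) \<in> parcs Q)"
proof -
  interpret comp: digraph_composition T H
    using assms(1,3-5) by (simp add: digraph_composition_def digraph_composition_axioms_def)
  have adjacent: "(s, x) \<in> parcs Q \<or> (x, s) \<in> parcs Q" if "s \<in> S" "x \<in> pverts Q - S" for s x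
    using comp.minimal_separator_adjacent assms(6,7,9,10) that by blast
  have "pair_digraph Q"
    using comp.Q.pair_digraph_axioms assms(6) by simp
  moreover have "S \<subseteq> pverts Q"
    using assms(10) by (simp add: minimal_separator_def separator_def)
  ultimately show ?thesis
    using pair_digraph.induce_complement_eq_Union_sccs[OF _ _ adjacent] adjacent by simp
qed

end
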